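(* Let $k \in \mathbb{N}$, let $G_{k}=(V,E)$ be a $k$-regular graph, let $d>0$, let $f:\mathbb{R}\to\mathbb{R}$ be continuous, and let $u:V\to\mathbb{R}$ satisfy $$0 = d \sum_{j \in N(i)}(u_j-u_i)+f(u_i), \quad i \in V,$$ and $|\mathrm{Im}(u)|=2$. Then there exist a matrix $\mathbf{m} \in \mathbb{N}_{0}^{2 \times 2}$ with $\sum_{j=1}^2 m_{ij}=k$ for $i = 1,2$ and an $\mathbf{m}$-perfect coloring $\Gamma:V\to\{1,2\}$ of $G_k$ such that $u$ is constant on each of the nonempty sets $\Gamma^{-1}(1)$, $\Gamma^{-1}(2)$, and the vector $v\in\mathbb{R}^2$ whose entry $v_c$ is the value of $u$ on $\Gamma^{-1}(c)$, $c=1,2$, solves $$0 = d(\mathbf{m} \cdot v - k v) + F(v).$$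
   Context: Graphs are undirected and simple, with a finite or countably infinite vertex set $V$; $N(i)=\{j\in V:\{i,j\}\in E\}$; $G_k$ is $k$-regular if $|N(i)|=k$ for all $i\in V$. $\mathrm{Im}(u)$ is the set of values of $u$. $F(v)=(f(v_1),f(v_2))$ is the componentwise application of $f$. A coloring $\Gamma:V\to C=\{1,\dots,n\}$ is $\mathbf{m}$-perfect, for $\mathbf{m}\in\mathbb{N}_0^{n\times n}$ with all row sums equal to $k$, if for every $i\in V$ and every $c\in C$ the number of $j\in N(i)$ with $\Gamma(j)=c$ equals $m_{\Gamma(i)c}$. *)

theory Defs
  imports "HOL-Analysis.Analysis"
begin

text \<open>
  The graph library in the AFP models graphs as finite symmetric digraphs. Here the vertex set may be
  countably infinite, so an undirected simple graph is given directly by its vertex set and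
  its set of two-element edges.
\<close>

definition simple_graph :: "'a set \<Rightarrow> 'a set set \<Rightarrow> bool" where
  "simple_graph V E \<longleftrightarrow> countable V \<and> (\<forall>e\<in>E. e \<subseteq> V \<and> card e = 2)"

definition nbhd :: "'a set \<Rightarrow> 'a set set \<Rightarrow> 'a \<Rightarrow> 'a set" where
  "nbhd V E i = {j \<in> V. {i, j} \<in> E}"

text \<open>Finiteness is required separately because the cardinality of an infinite set is \<open>0\<close> in HOL.\<close>

definition regular_graph :: "nat \<Rightarrow> 'a set \<Rightarrow> 'a set set \<Rightarrow> bool" where
  "regular_graph k V E \<longleftrightarrow> simple_graph V E \<and>
     (\<forall>i\<in>V. finite (nbhd V E i) \<and> card (nbhd V E i) = k)"

text \<open>
  The colours are the elements of a finite index type \<open>'n\<close>; for two colours this is the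
  numeral type \<open>2\<close>, whose elements are \<open>1\<close> and \<open>2\<close>. Only the values
  of \<open>\<Gamma>\<close> on \<open>V\<close> matter.
\<close>

definition perfect_coloring ::
  "'a set \<Rightarrow> 'a set set \<Rightarrow> nat ^ 'n ^ 'n \<Rightarrow> ('a \<Rightarrow> 'n::finite) \<Rightarrow> bool" where
  "perfect_coloring V E m \<Gamma> \<longleftrightarrow>
     (\<forall>i\<in>V. \<forall>c. finite {j \<in> nbhd V E i. \<Gamma> j = c} \<and>
        card {j \<in> nbhd V E i. \<Gamma> j = c} = m $ \<Gamma> i $ c)"

definition real_matrix :: "nat ^ 'n ^ 'm \<Rightarrow> real ^ 'n ^ 'm" where
  "real_matrix m = (\<chi> i j. real (m $ i $ j))"

definition componentwise :: "(real \<Rightarrow> real) \<Rightarrow> real ^ 'n \<Rightarrow> real ^ 'n" where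
  "componentwise f v = (\<chi> c. f (v $ c))"

end

theory Submission
  imports Defs
begin

text \<open>
  Colour the vertices by the value of \<open>u\<close>. At a vertex of colour \<open>c\<close> the sum of the
  differences \<open>u j - u i\<close> depends only on how many neighbours have each colour: with these counts
  written \<open>n c'\<close>, it is the weighted sum of the values \<open>v c'\<close> minus \<open>k * v c\<close>
  (\<open>sum_differences_by_colour\<close>). The stationary equation fixes this sum in terms of \<open>c\<close>, because
  \<open>d\<close> is nonzero, and regularity fixes the total of the counts. With two colours these are two
  linear equations in two unknowns, with determinant \<open>v 2 - v 1\<close>, which is nonzero
  (\<open>two_weights_determine_counts\<close>). So the counts depend only on the colour of the vertex, which is
  perfectness, and the equation at a vertex of each colour is the reduced equation for \<open>v\<close>.
  With three or more colours the two equations would no longer determine the counts.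
\<close>

definition colour_count ::
  "'a set \<Rightarrow> 'a set set \<Rightarrow> ('a \<Rightarrow> 'n) \<Rightarrow> 'a \<Rightarrow> 'n \<Rightarrow> nat" where
  "colour_count V E \<Gamma> i c = card {j \<in> nbhd V E i. \<Gamma> j = c}"

lemma sum_colour_count:
  fixes \<Gamma> :: "'a \<Rightarrow> 'n::finite"
  assumes "finite (nbhd V E i)"
  shows "(\<Sum>c\<in>UNIV. colour_count V E \<Gamma> i c) = card (nbhd V E i)"
  using sum.group[OF assms finite_class.finite_UNIV subset_UNIV, where g = \<Gamma> and h = "\<lambda>_. 1::nat"]
  by (simp add: colour_count_def)

text \<open>
  Grouping the neighbours by colour turns a sum over the neighbourhood into a sum over the colours.
\<close>

lemma sum_differences_by_colour:
  fixes \<Gamma> :: "'a \<Rightarrow> 'n::finite" and u :: "'a \<Rightarrow> real"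
  assumes fin: "finite (nbhd V E i)"
    and u: "\<And>j. j \<in> nbhd V E i \<Longrightarrow> u j = v (\<Gamma> j)"
  shows "(\<Sum>j\<in>nbhd V E i. u j - x) =
    (\<Sum>c\<in>UNIV. real (colour_count V E \<Gamma> i c) * v c) - real (card (nbhd V E i)) * x"
proof -
  have "(\<Sum>j\<in>nbhd V E i. u j) = (\<Sum>j\<in>nbhd V E i. v (\<Gamma> j))"
    using u by (intro sum.cong) auto
  also have "\<dots> = (\<Sum>c\<in>UNIV. \<Sum>j | j \<in> nbhd V E i \<and> \<Gamma> j = c. v (\<Gamma> j))"
    using sum.group[OF fin finite_class.finite_UNIV subset_UNIV,
      where g = \<Gamma> and h = "\<lambda>j. v (\<Gamma> j)"] by simp
  also have "\<dots> = (\<Sum>c\<in>UNIV. real (colour_count V E \<Gamma> i c) * v c)"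
    by (simp add: colour_count_def)
  finally show ?thesis
    by (simp add: sum_subtractf)
qed

lemma two_weights_determine_counts:
  fixes n n' :: "2 \<Rightarrow> nat" and v :: "2 \<Rightarrow> real"
  assumes "v 1 \<noteq> v 2"
    and total: "(\<Sum>c\<in>UNIV. n c) = (\<Sum>c\<in>UNIV. n' c)"
    and weighted: "(\<Sum>c\<in>UNIV. real (n c) * v c) = (\<Sum>c\<in>UNIV. real (n' c) * v c)"
  shows "n = n'"
proof -
  have t: "n 1 + n 2 = n' 1 + n' 2"
    using total by (simp add: sum_2)
  then have t': "real (n 2) = real (n' 1) + real (n' 2) - real (n 1)"
    by linarith
  have "(real (n 1) - real (n' 1)) * (v 1 - v 2) = 0"
    using weighted by (simp add: sum_2 t' algebra_simps)
  then have "n 1 = n' 1"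
    using assms(1) by simp
  with t show ?thesis
    by (simp add: fun_eq_iff forall_2)
qed

theorem lemma3p6:
  fixes k :: nat and V :: "'a set" and E :: "'a set set"
    and d :: real and f :: "real \<Rightarrow> real" and u :: "'a \<Rightarrow> real"
  assumes "k \<ge> 1"
    and "regular_graph k V E"
    and "d > 0"
    and "continuous_on UNIV f"
    and "\<And>i. i \<in> V \<Longrightarrow> 0 = d * (\<Sum>j\<in>nbhd V E i. u j - u i) + f (u i)"
    and "card (u ` V) = 2"
  shows "\<exists>(m :: nat ^ 2 ^ 2) (\<Gamma> :: 'a \<Rightarrow> 2) (v :: real ^ 2).
      (\<forall>i. (\<Sum>j\<in>UNIV. m $ i $ j) = k) \<and>
      perfect_coloring V E m \<Gamma> \<and>
      (\<forall>c. {i \<in> V. \<Gamma> i = c} \<noteq> {} \<and> (\<forall>i\<in>{i \<in> V. \<Gamma> i = c}. u i = v $ c)) \<and>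
      0 = d *\<^sub>R (real_matrix m *v v - real k *\<^sub>R v) + componentwise f v"
proof -
  obtain a b where im: "u ` V = {a, b}" and ab: "a \<noteq> b"
    using assms(6) by (auto simp: card_2_iff)
  define \<Gamma> :: "'a \<Rightarrow> 2" where "\<Gamma> i = (if u i = a then 1 else 2)" for i
  define v :: "real ^ 2" where "v = (\<chi> c. if c = 1 then a else b)"
  have v12: "v $ 1 \<noteq> v $ 2"
    using ab by (simp add: v_def)
  have u_eq: "u i = v $ \<Gamma> i" if "i \<in> V" for i
    using im that by (auto simp: \<Gamma>_def v_def)
  have "\<exists>i\<in>V. \<Gamma> i = c" for c
  proof -
    have "v $ c \<in> u ` V"
      by (simp add: im v_def)
    then obtain i where i: "i \<in> V" "u i = v $ c"
      by auto
    then have "v $ \<Gamma> i = v $ c"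
      using u_eq by simp
    with v12 have "\<Gamma> i = c"
      using exhaust_2[of c] exhaust_2[of "\<Gamma> i"] by auto
    with i show ?thesis by blast
  qed
  then obtain r where r: "\<And>c. r c \<in> V" "\<And>c. \<Gamma> (r c) = c"
    by metis
  let ?n = "colour_count V E \<Gamma>"
  have fin: "finite (nbhd V E i)" and deg: "card (nbhd V E i) = k" if "i \<in> V" for i
    using assms(2) that by (auto simp: regular_graph_def)
  have total: "(\<Sum>c\<in>UNIV. ?n i c) = k" if "i \<in> V" for i
    using sum_colour_count[OF fin[OF that]] deg[OF that] by simp
  have eq: "0 = d * ((\<Sum>c\<in>UNIV. real (?n i c) * v $ c) - real k * v $ \<Gamma> i) + f (v $ \<Gamma> i)"
    if "i \<in> V" for i
  proof -
    have "u j = v $ \<Gamma> j" if "j \<in> nbhd V E i" for j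
      using that u_eq by (simp add: nbhd_def)
    from sum_differences_by_colour[where v = "\<lambda>c. v $ c" and x = "u i", OF fin[OF that] this]
    show ?thesis
      using assms(5)[OF that] u_eq[OF that] deg[OF that] by simp
  qed
  \<comment> \<open>Any vertex of a given colour can serve to read off the corresponding row of the matrix.\<close>
  have same: "?n i = ?n (r (\<Gamma> i))" if "i \<in> V" for i
  proof (rule two_weights_determine_counts[of "\<lambda>c. v $ c"])
    show "v $ 1 \<noteq> v $ 2" by (rule v12)
    show "(\<Sum>c\<in>UNIV. ?n i c) = (\<Sum>c\<in>UNIV. ?n (r (\<Gamma> i)) c)"
      using total that r by simp
    have "d * (\<Sum>c\<in>UNIV. real (?n i c) * v $ c) =
        d * (\<Sum>c\<in>UNIV. real (?n (r (\<Gamma> i)) c) * v $ c)"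
      using eq[OF that] eq[OF r(1)[of "\<Gamma> i"]]
      unfolding r(2) right_diff_distrib by linarith
    then show "(\<Sum>c\<in>UNIV. real (?n i c) * v $ c) =
        (\<Sum>c\<in>UNIV. real (?n (r (\<Gamma> i)) c) * v $ c)"
      using \<open>d > 0\<close> by simp
  qed
  define m :: "nat ^ 2 ^ 2" where "m = (\<chi> c c'. ?n (r c) c')"
  have m: "m $ c $ c' = ?n (r c) c'" for c c'
    by (simp add: m_def)
  have rows: "\<forall>c. (\<Sum>c'\<in>UNIV. m $ c $ c') = k"
    using total r(1) by (simp add: m)
  have perfect: "perfect_coloring V E m \<Gamma>"
    unfolding perfect_coloring_def
  proof (intro ballI allI conjI)
    fix i c assume i: "i \<in> V"
    show "finite {j \<in> nbhd V E i. \<Gamma> j = c}"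
      using fin[OF i] by simp
    show "card {j \<in> nbhd V E i. \<Gamma> j = c} = m $ \<Gamma> i $ c"
      using fun_cong[OF same[OF i], of c] by (simp add: m colour_count_def)
  qed
  have classes: "\<forall>c. {i \<in> V. \<Gamma> i = c} \<noteq> {} \<and> (\<forall>i\<in>{i \<in> V. \<Gamma> i = c}. u i = v $ c)"
    using r u_eq by blast
  have reduced: "0 = d *\<^sub>R (real_matrix m *v v - real k *\<^sub>R v) + componentwise f v"
  proof -
    have "0 = d * ((\<Sum>c'\<in>UNIV. real (m $ c $ c') * v $ c') - real k * v $ c) + f (v $ c)" for c
      using eq[OF r(1)[of c]] r(2)[of c] by (simp add: m)
    then show ?thesis
      by (simp add: vec_eq_iff real_matrix_def matrix_vector_mult_def componentwise_def)
  qed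
  from rows perfect classes reduced show ?thesis
    by blast
qed

end
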